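(* The class of languages accepted by residual nominal automata is not closed under union, intersection, reversal, or complement. Concretely, let $\Sigma=\mathbb{A}\cup\{\mathsf{Anc}(a)\mid a\in\mathbb{A}\}$ and $\mathcal{L}_{\mathrm{r}}=\{wa\mid a\in\mathbb{A},\ w\in((\mathbb{A}\setminus\{a\})\cup\{\mathsf{Anc}(a)\})^*\}\cup\{\epsilon\}$, which is accepted by a residual automaton, and $\mathcal{L}_2=\mathbb{A}^*\subseteq\Sigma^*$, which is accepted by a deterministic (hence residual) automaton. Then: (Union) $\mathcal{L}_{\mathrm{r}}\cup\mathcal{L}_2$ is not accepted by any residual automaton. (Intersection) $\mathcal{L}_{\mathrm{r}}\cap\mathcal{L}_2$ is not accepted by any residual automaton. (Reversal) The language $\{aw\mid a\in\mathbb{A},w\in\mathbb{A}^*,a\text{ does not occur in }w\}$ is accepted by a deterministic (hence residual) automaton, but its reversal is not accepted by any residual automaton. (Complement) The language $\{uavaw\mid u,v,w\in\mathbb{A}^*,a\in\mathbb{A}\}\subseteq\mathbb{A}^*$ is accepted by a residual automaton, but its complement in $\mathbb{A}^*$ is not accepted by any nominal automaton, in particular by no residual one.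
   Context: Nominal sets: $\mathbb{A}$ is a countably infinite set of atoms and $\mathrm{Perm}(\mathbb{A})$ is the group of finite permutations of $\mathbb{A}$. A nominal set is a set with a $\mathrm{Perm}(\mathbb{A})$-action in which every element $x$ has a finite support (a finite $A\subseteq\mathbb{A}$ such that $\pi x=x$ whenever $\pi$ fixes $A$ pointwise). A subset $U$ is equivariant if $\pi U=U$ for all $\pi$. A nominal set is orbit-finite if it is a finite union of orbits. A nominal automaton consists of an orbit-finite nominal alphabet $\Sigma$, an orbit-finite nominal set $Q$ of states, and equivariant subsets $I\subseteq Q$ (initial), $F\subseteq Q$ (final), $\delta\subseteq Q\times\Sigma\times Q$ (transitions), with the usual (nondeterministic) acceptance; $[\![q]\!]$ is the language accepted from $q$. It is deterministic if $I$ is a singleton and for each $q\in Q,a\in\Sigma$ there is a unique $q'$ with $(q,a,q')\in\delta$. It is residual if for each $q\in Q$ there is a word $w\in\Sigma^*$ with $[\![q]\!]=w^{-1}\mathcal{L}(\mathcal{A})=\{v\mid wv\in\mathcal{L}(\mathcal{A})\}$. $\mathsf{Anc}$ is a label, with action $\pi\cdot\mathsf{Anc}(a)=\mathsf{Anc}(\pi(a))$, and the $\mathsf{Anc}(a)$ are distinct from the atoms. *)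

theory Defs
  imports
    "HOL-Algebra.Group_Action"
    "HOL-Combinatorics.Perm"
    "HOL-Library.Countable_Set"
    "HOL-Library.Infinite_Typeclass"
begin

hide_const (open) Perm.orbit Perm.order

notation Perm.apply (infixl \<open>\<langle>$\<rangle>\<close> 999)

text \<open>
  The set of atoms is the universe of a type \<open>'v\<close> that is countable and infinite.
  Finite permutations of the atoms are the elements of the library type \<open>'v perm\<close>
  (bijections that move only finitely many points).
\<close>

definition perm_group :: "'v perm monoid" where
  "perm_group = \<lparr>carrier = UNIV, mult = (*), one = 1\<rparr>"

type_synonym ('v, 'x) action = "'v perm \<Rightarrow> 'x \<Rightarrow> 'x"


subsection \<open>Nominal sets\<close>

definition supports :: "('v, 'x) action \<Rightarrow> 'v set \<Rightarrow> 'x \<Rightarrow> bool" where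
  "supports \<phi> S x \<longleftrightarrow> (\<forall>\<pi>. (\<forall>a\<in>S. \<pi> \<langle>$\<rangle> a = a) \<longrightarrow> \<phi> \<pi> x = x)"

text \<open>
  As usual in HOL-Algebra, \<open>group_action\<close> requires each \<open>\<phi> \<pi>\<close> to be
  \<open>undefined\<close> outside the carrier \<open>X\<close>; this is only a normalisation of irrelevant values.
\<close>

definition nominal_set :: "'x set \<Rightarrow> ('v, 'x) action \<Rightarrow> bool" where
  "nominal_set X \<phi> \<longleftrightarrow>
     group_action perm_group X \<phi> \<and> (\<forall>x\<in>X. \<exists>S. finite S \<and> supports \<phi> S x)"

definition orbit_finite :: "'x set \<Rightarrow> ('v, 'x) action \<Rightarrow> bool" where
  "orbit_finite X \<phi> \<longleftrightarrow> finite (orbits perm_group X \<phi>)"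

definition equivariant :: "('v, 'x) action \<Rightarrow> 'x set \<Rightarrow> bool" where
  "equivariant \<phi> U \<longleftrightarrow> (\<forall>\<pi>. \<phi> \<pi> ` U = U)"


subsection \<open>Nominal automata\<close>

record ('v, 's, 'q) nominal_aut =
  alphabet :: "'s set"
  alphabet_act :: "('v, 's) action"
  states :: "'q set"
  states_act :: "('v, 'q) action"
  initial :: "'q set"
  final :: "'q set"
  trans_rel :: "('q \<times> 's \<times> 'q) set"

definition trans_act :: "('v, 's, 'q) nominal_aut \<Rightarrow> ('v, 'q \<times> 's \<times> 'q) action" where
  "trans_act A \<pi> = (\<lambda>(q, a, q'). (states_act A \<pi> q, alphabet_act A \<pi> a, states_act A \<pi> q'))"

definition nominal_automaton :: "('v, 's, 'q) nominal_aut \<Rightarrow> bool" where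
  "nominal_automaton A \<longleftrightarrow>
     nominal_set (alphabet A) (alphabet_act A) \<and> orbit_finite (alphabet A) (alphabet_act A) \<and>
     nominal_set (states A) (states_act A) \<and> orbit_finite (states A) (states_act A) \<and>
     initial A \<subseteq> states A \<and> equivariant (states_act A) (initial A) \<and>
     final A \<subseteq> states A \<and> equivariant (states_act A) (final A) \<and>
     trans_rel A \<subseteq> states A \<times> alphabet A \<times> states A \<and> equivariant (trans_act A) (trans_rel A)"

primrec accepts_from :: "('v, 's, 'q) nominal_aut \<Rightarrow> 's list \<Rightarrow> 'q \<Rightarrow> bool" where
  "accepts_from A [] q \<longleftrightarrow> q \<in> final A"
| "accepts_from A (a # w) q \<longleftrightarrow> (\<exists>q'. (q, a, q') \<in> trans_rel A \<and> accepts_from A w q')"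

definition language_from :: "('v, 's, 'q) nominal_aut \<Rightarrow> 'q \<Rightarrow> 's list set" where
  "language_from A q = {w. accepts_from A w q}"

definition language :: "('v, 's, 'q) nominal_aut \<Rightarrow> 's list set" where
  "language A = (\<Union>q\<in>initial A. language_from A q)"

definition left_quotient :: "'s list \<Rightarrow> 's list set \<Rightarrow> 's list set" where
  "left_quotient w L = {v. w @ v \<in> L}"

definition deterministic :: "('v, 's, 'q) nominal_aut \<Rightarrow> bool" where
  "deterministic A \<longleftrightarrow>
     (\<exists>q. initial A = {q}) \<and>
     (\<forall>q\<in>states A. \<forall>a\<in>alphabet A. \<exists>!q'. (q, a, q') \<in> trans_rel A)"

definition residual :: "('v, 's, 'q) nominal_aut \<Rightarrow> bool" where
  "residual A \<longleftrightarrow>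
     (\<forall>q\<in>states A. \<exists>w\<in>lists (alphabet A). language_from A q = left_quotient w (language A))"

text \<open>
  The first argument fixes the type from which the states are drawn.
\<close>

definition accepted_by ::
  "'q itself \<Rightarrow> (('v, 's, 'q) nominal_aut \<Rightarrow> bool) \<Rightarrow> 's set \<Rightarrow> ('v, 's) action \<Rightarrow> 's list set \<Rightarrow> bool"
where
  "accepted_by T P \<Sigma> \<rho> L \<longleftrightarrow>
     (\<exists>A. nominal_automaton A \<and> P A \<and> alphabet A = \<Sigma> \<and> alphabet_act A = \<rho> \<and> language A = L)"


subsection \<open>State sets as sets of natural numbers\<close>

text \<open>
  Over countably many atoms an orbit-finite nominal set is countable, so drawing states from
  the natural numbers is no restriction (\<open>accepted_by_nat\<close> below).  This allows
  the class of all residual languages over an alphabet to be defined as a single set.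
\<close>

lemma countable_perm: "countable (UNIV :: 'v::countable perm set)"
proof -
  let ?f = "\<lambda>p :: 'v perm. (\<lambda>a. (a, p \<langle>$\<rangle> a)) ` affected p"
  have "inj ?f"
  proof (rule injI, rule perm_eqI)
    fix p q :: "'v perm" and a
    assume eq: "?f p = ?f q"
    have "p \<langle>$\<rangle> a = b \<longleftrightarrow> q \<langle>$\<rangle> a = b" if "a \<noteq> b" for b
    proof -
      have "p \<langle>$\<rangle> a = b \<longleftrightarrow> (a, b) \<in> ?f p" using that by (auto simp: in_affected)
      moreover have "q \<langle>$\<rangle> a = b \<longleftrightarrow> (a, b) \<in> ?f q" using that by (auto simp: in_affected)
      ultimately show ?thesis using eq by simp
    qed
    then show "p \<langle>$\<rangle> a = q \<langle>$\<rangle> a" by metis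
  qed
  moreover have "countable (range ?f)"
    by (rule countable_subset[OF _ countable_Collect_finite]) auto
  ultimately show ?thesis
    by (metis countable_image_inj_on)
qed

lemma group_perm_group: "group (perm_group :: 'v perm monoid)"
  by (rule groupI) (auto simp: perm_group_def mult.assoc intro: perm.left_inverse)

lemma group_action_perm_iff:
  "group_action (perm_group :: 'v perm monoid) X \<phi> \<longleftrightarrow>
     (\<forall>\<pi>. \<phi> \<pi> \<in> extensional X) \<and> (\<forall>\<pi>. \<forall>x\<in>X. \<phi> \<pi> x \<in> X) \<and>
     (\<forall>x\<in>X. \<phi> 1 x = x) \<and> (\<forall>\<pi> \<sigma>. \<forall>x\<in>X. \<phi> (\<pi> * \<sigma>) x = \<phi> \<pi> (\<phi> \<sigma> x))"
  (is "?L \<longleftrightarrow> ?R")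
proof
  assume ?L
  then interpret group_action "perm_group :: 'v perm monoid" X \<phi> .
  have c: "\<pi> \<in> carrier perm_group" for \<pi> :: "'v perm" by (simp add: perm_group_def)
  have e: "\<forall>\<pi>. \<phi> \<pi> \<in> extensional X" using bij_prop0[OF c] by (auto simp: Bij_def)
  have m: "\<forall>\<pi>. \<forall>x\<in>X. \<phi> \<pi> x \<in> X" using element_image[OF c] by blast
  have o: "\<forall>x\<in>X. \<phi> 1 x = x"
    using id_eq_one by (metis perm_group_def monoid.select_convs(2) restrict_apply')
  have "\<forall>\<pi> \<sigma>. \<forall>x\<in>X. \<phi> (\<pi> * \<sigma>) x = \<phi> \<pi> (\<phi> \<sigma> x)"
    using composition_rule[OF _ c c] by (simp add: perm_group_def)
  with e m o show ?R by blast
next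
  assume R: ?R
  have bij: "\<phi> \<pi> \<in> Bij X" for \<pi>
  proof -
    have l: "\<phi> (inverse \<pi>) (\<phi> \<pi> x) = x" and r: "\<phi> \<pi> (\<phi> (inverse \<pi>) x) = x" if "x \<in> X" for x
      using R that by (metis perm.left_inverse, metis perm.right_inverse)
    have "bij_betw (\<phi> \<pi>) X X"
      by (rule bij_betw_byWitness[where f' = "\<phi> (inverse \<pi>)"]) (use l r R in auto)
    then show ?thesis using R by (simp add: Bij_def)
  qed
  have "\<phi> (\<pi> * \<sigma>) = compose X (\<phi> \<pi>) (\<phi> \<sigma>)" for \<pi> \<sigma>
    by (rule extensionalityI[where A = X]) (use R in \<open>auto simp: compose_eq\<close>)
  then show ?L
    unfolding group_action_def group_hom_def group_hom_axioms_def
    using group_perm_group group_BijGroup[of X] bij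
    by (auto simp: hom_def BijGroup_def perm_group_def)
qed

lemma countable_orbit_finite:
  fixes \<phi> :: "('v::countable, 'x) action"
  assumes "nominal_set X \<phi>" "orbit_finite X \<phi>"
  shows "countable X"
proof -
  have "countable (orbit perm_group \<phi> x)" for x
  proof -
    have "orbit perm_group \<phi> x = (\<lambda>\<pi>. \<phi> \<pi> x) ` UNIV"
      by (auto simp: Group_Action.orbit_def perm_group_def)
    then show ?thesis by (simp add: countable_image[OF countable_perm])
  qed
  then have "\<forall>Y\<in>orbits perm_group X \<phi>. countable Y"
    by (auto simp: orbits_def)
  then have "countable (\<Union>Y\<in>orbits perm_group X \<phi>. Y)"
    by (intro countable_UN countable_finite[OF assms(2)[unfolded orbit_finite_def]]) blast
  moreover have "x \<in> orbit perm_group \<phi> x" if "x \<in> X" for x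
    using assms(1) that group_action.orbit_refl by (fastforce simp: nominal_set_def)
  then have "X \<subseteq> (\<Union>Y\<in>orbits perm_group X \<phi>. Y)"
    by (auto simp: orbits_def)
  ultimately show ?thesis by (rule countable_subset[rotated])
qed

lemma accepted_by_nat_aux:
  fixes A :: "('v::countable, 's, 'q) nominal_aut"
  assumes A: "nominal_automaton A"
  shows "\<exists>B :: ('v, 's, nat) nominal_aut.
    nominal_automaton B \<and> alphabet B = alphabet A \<and> alphabet_act B = alphabet_act A \<and>
    language B = language A \<and> (residual A \<longrightarrow> residual B) \<and> (deterministic A \<longrightarrow> deterministic B)"
proof -
  let ?Q = "states A" and ?\<phi> = "states_act A"
  have "countable ?Q"
    using A countable_orbit_finite by (auto simp: nominal_automaton_def)
  then obtain f :: "'q \<Rightarrow> nat" where inj: "inj_on f ?Q"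
    by (rule countableE)
  define g where "g = inv_into ?Q f"
  have gf [simp]: "g (f q) = q" if "q \<in> ?Q" for q
    using inj that by (simp add: g_def)
  define \<psi> where "\<psi> = (\<lambda>\<pi>. \<lambda>n\<in>f ` ?Q. f (?\<phi> \<pi> (g n)))"
  define F where "F = (\<lambda>(q, a :: 's, q'). (f q, a, f q'))"
  define B where "B = \<lparr>alphabet = alphabet A, alphabet_act = alphabet_act A,
    states = f ` ?Q, states_act = \<psi>, initial = f ` initial A, final = f ` final A,
    trans_rel = F ` trans_rel A\<rparr>"
  have sub: "initial A \<subseteq> ?Q" "final A \<subseteq> ?Q" "trans_rel A \<subseteq> ?Q \<times> alphabet A \<times> ?Q"
    using A by (auto simp: nominal_automaton_def)
  have act: "group_action perm_group ?Q ?\<phi>"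
    using A by (auto simp: nominal_automaton_def nominal_set_def)
  have mem: "?\<phi> \<pi> q \<in> ?Q" if "q \<in> ?Q" for \<pi> q
    using act that by (simp add: group_action_perm_iff)
  have psi [simp]: "\<psi> \<pi> (f q) = f (?\<phi> \<pi> q)" if "q \<in> ?Q" for \<pi> q
    using that by (simp add: \<psi>_def)
  have actB: "group_action perm_group (f ` ?Q) \<psi>"
    using act unfolding group_action_perm_iff
    by (auto simp: mem) (auto simp: \<psi>_def)
  have nomB: "nominal_set (f ` ?Q) \<psi>"
    unfolding nominal_set_def
  proof (intro conjI actB ballI)
    fix n assume "n \<in> f ` ?Q"
    then obtain q where q: "q \<in> ?Q" "n = f q" by blast
    then obtain S where "finite S" "supports ?\<phi> S q"
      using A by (auto simp: nominal_automaton_def nominal_set_def)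
    then show "\<exists>S. finite S \<and> supports \<psi> S n"
      using q by (auto simp: supports_def intro!: exI[of _ S])
  qed
  have "orbits perm_group (f ` ?Q) \<psi> = (`) f ` orbits perm_group ?Q ?\<phi>"
  proof -
    have "orbit perm_group \<psi> (f q) = f ` orbit perm_group ?\<phi> q" if "q \<in> ?Q" for q
      using that by (auto simp: Group_Action.orbit_def perm_group_def)
    then show ?thesis by (force simp: orbits_def)
  qed
  then have orbB: "orbit_finite (f ` ?Q) \<psi>"
    using A by (simp add: nominal_automaton_def orbit_finite_def)
  have eqv: "equivariant \<psi> (f ` U)" if "U \<subseteq> ?Q" "equivariant ?\<phi> U" for U
  proof -
    have "\<psi> \<pi> ` f ` U = f ` ?\<phi> \<pi> ` U" for \<pi>
      using that(1) by (force simp: image_image)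
    then show ?thesis using that(2) by (simp add: equivariant_def)
  qed
  have "trans_act B \<pi> ` F ` trans_rel A = F ` trans_act A \<pi> ` trans_rel A" for \<pi>
    unfolding image_image
    by (rule image_cong) (use sub(3) in \<open>auto simp: trans_act_def F_def B_def\<close>)
  then have eqT: "equivariant (trans_act B) (F ` trans_rel A)"
    using A by (simp add: nominal_automaton_def equivariant_def)
  have "nominal_automaton B"
    using A nomB orbB eqv eqT sub
    unfolding nominal_automaton_def by (auto simp: B_def F_def)
  moreover have tr: "(f q, a, n) \<in> trans_rel B \<longleftrightarrow> (\<exists>q'. n = f q' \<and> (q, a, q') \<in> trans_rel A)"
    if "q \<in> ?Q" for q a n
  proof
    assume "(f q, a, n) \<in> trans_rel B"
    then obtain p p' where p: "(p, a, p') \<in> trans_rel A" "f p = f q" "n = f p'"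
      by (auto simp: B_def F_def)
    then have "p = q" using inj sub(3) that by (auto dest: inj_onD)
    then show "\<exists>q'. n = f q' \<and> (q, a, q') \<in> trans_rel A" using p by auto
  qed (force simp: B_def F_def)
  have fin: "f q \<in> final B \<longleftrightarrow> q \<in> final A" if "q \<in> ?Q" for q
    using inj that sub(2) by (auto simp: B_def dest: inj_onD)
  have acc: "accepts_from B w (f q) \<longleftrightarrow> accepts_from A w q" if "q \<in> ?Q" for w q
    using that
  proof (induction w arbitrary: q)
    case (Cons a w)
    have "accepts_from B (a # w) (f q) \<longleftrightarrow> (\<exists>q'. (q, a, q') \<in> trans_rel A \<and> accepts_from B w (f q'))"
      using tr[OF Cons.prems] by auto
    also have "\<dots> \<longleftrightarrow> accepts_from A (a # w) q"
      using Cons.IH sub(3) by auto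
    finally show ?case .
  qed (simp add: fin)
  then have langq: "language_from B (f q) = language_from A q" if "q \<in> ?Q" for q
    using that by (simp add: language_from_def)
  have lang: "language B = language A"
    unfolding language_def using sub(1) langq by (auto simp: B_def)
  have "residual A \<longrightarrow> residual B"
    unfolding residual_def lang using langq by (auto simp: B_def)
  moreover have "deterministic A \<longrightarrow> deterministic B"
  proof
    assume det: "deterministic A"
    have "\<exists>!n. (f q, a, n) \<in> trans_rel B" if q: "q \<in> ?Q" and a: "a \<in> alphabet A" for q a
      using det q a unfolding tr[OF q] deterministic_def by metis
    then show "deterministic B"
      using det by (auto simp: deterministic_def B_def)
  qed
  ultimately show ?thesis
    using lang by (intro exI[of _ B]) (simp add: B_def)
qed

lemma accepted_by_nat:
  fixes \<rho> :: "('v::countable, 's) action" and T :: "'q itself"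
  shows "accepted_by T residual \<Sigma> \<rho> L \<Longrightarrow> accepted_by TYPE(nat) residual \<Sigma> \<rho> L"
    and "accepted_by T (\<lambda>A. deterministic A \<and> residual A) \<Sigma> \<rho> L \<Longrightarrow>
         accepted_by TYPE(nat) (\<lambda>A. deterministic A \<and> residual A) \<Sigma> \<rho> L"
    and "accepted_by T (\<lambda>_. True) \<Sigma> \<rho> L \<Longrightarrow> accepted_by TYPE(nat) (\<lambda>_. True) \<Sigma> \<rho> L"
proof -
  have *: "accepted_by TYPE(nat) P' \<Sigma> \<rho> L" if T: "accepted_by T P \<Sigma> \<rho> L"
    and P: "\<And>A :: ('v, 's, 'q) nominal_aut. \<And>B :: ('v, 's, nat) nominal_aut.
       P A \<Longrightarrow> residual A \<longrightarrow> residual B \<Longrightarrow> deterministic A \<longrightarrow> deterministic B \<Longrightarrow> P' B"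
    for P and P' :: "('v, 's, nat) nominal_aut \<Rightarrow> bool"
  proof -
    obtain A :: "('v, 's, 'q) nominal_aut" where A: "nominal_automaton A" "P A" "alphabet A = \<Sigma>"
      "alphabet_act A = \<rho>" "language A = L"
      using T unfolding accepted_by_def by blast
    obtain B :: "('v, 's, nat) nominal_aut" where B: "nominal_automaton B"
      "alphabet B = alphabet A" "alphabet_act B = alphabet_act A" "language B = language A"
      "residual A \<longrightarrow> residual B" "deterministic A \<longrightarrow> deterministic B"
      using accepted_by_nat_aux[OF A(1)] by blast
    show ?thesis
      unfolding accepted_by_def using A B P[OF A(2) B(5,6)] by blast
  qed
  show "accepted_by T residual \<Sigma> \<rho> L \<Longrightarrow> accepted_by TYPE(nat) residual \<Sigma> \<rho> L"
    by (erule *) blast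
  show "accepted_by T (\<lambda>A. deterministic A \<and> residual A) \<Sigma> \<rho> L \<Longrightarrow>
         accepted_by TYPE(nat) (\<lambda>A. deterministic A \<and> residual A) \<Sigma> \<rho> L"
    by (erule *) blast
  show "accepted_by T (\<lambda>_. True) \<Sigma> \<rho> L \<Longrightarrow> accepted_by TYPE(nat) (\<lambda>_. True) \<Sigma> \<rho> L"
    by (erule *) blast
qed

definition residual_languages :: "'s set \<Rightarrow> ('v, 's) action \<Rightarrow> 's list set set" where
  "residual_languages \<Sigma> \<rho> = {L. accepted_by TYPE(nat) residual \<Sigma> \<rho> L}"


subsection \<open>The alphabets and languages of the counterexamples\<close>

datatype 'v letter = Atom 'v | Anc 'v

definition atom_act :: "('v, 'v) action" where
  "atom_act \<pi> a = \<pi> \<langle>$\<rangle> a"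

definition letter_act :: "('v, 'v letter) action" where
  "letter_act \<pi> = map_letter (atom_act \<pi>)"

definition L_r :: "'v letter list set" where
  "L_r = {w @ [Atom a] | a w. w \<in> lists (Atom ` (UNIV - {a}) \<union> {Anc a})} \<union> {[]}"

definition L_2 :: "'v letter list set" where
  "L_2 = lists (range Atom)"

definition first_fresh :: "'v list set" where
  "first_fresh = {a # w | a w. a \<notin> set w}"

definition some_repeated :: "'v list set" where
  "some_repeated = {u @ [a] @ v @ [a] @ w | u v w a. True}"

end

theory Submission
  imports Defs
begin

text \<open>
  The states of a nominal automaton have supports of bounded size, and the language from a state
  is invariant under every permutation that fixes a support of the state.  In a residual
  automaton for \<open>L\<close>, a state that is reached by \<open>u\<close> and accepts some \<open>v\<close> has a language of the
  form \<open>w\<^sup>-\<^sup>1 L \<subseteq> u\<^sup>-\<^sup>1 L\<close>.  In the counterexamples this inclusion forces \<open>w\<close> to contain every atom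
  of \<open>u\<close>, and \<open>w\<^sup>-\<^sup>1 L\<close> distinguishes the atoms of \<open>w\<close> from the fresh ones; so a \<open>u\<close> with many
  atoms contradicts the bound on supports.  The complement of \<open>some_repeated\<close> consists of the
  words without repetition, and the same bound shows that no nominal automaton can remember
  the letters read so far.
\<close>

subsection \<open>Bounded supports\<close>

lemma nominal_set_action:
  assumes "nominal_set X \<phi>" "x \<in> X"
  shows "\<phi> \<pi> x \<in> X" "\<phi> 1 x = x" "\<phi> (\<pi> * \<sigma>) x = \<phi> \<pi> (\<phi> \<sigma> x)"
  using assms by (auto simp: nominal_set_def group_action_perm_iff)

lemma orbit_perm_group: "orbit perm_group \<phi> x = range (\<lambda>\<pi>. \<phi> \<pi> x)"
  by (auto simp: Group_Action.orbit_def perm_group_def)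

text \<open>By conjugation: if \<open>\<sigma>\<close> fixes the image of \<open>S\<close>
  pointwise, then \<open>inverse \<pi> * (\<sigma> * \<pi>)\<close> fixes \<open>S\<close> pointwise
  and therefore fixes \<open>x\<close>.\<close>

lemma supports_image:
  fixes \<phi> :: "('v, 'x) action"
  assumes X: "nominal_set X \<phi>" "x \<in> X" and S: "supports \<phi> S x"
  shows "supports \<phi> ((\<langle>$\<rangle>) \<pi> ` S) (\<phi> \<pi> x)"
  unfolding supports_def
proof (intro allI impI)
  fix \<sigma> :: "'v perm"
  assume fixed: "\<forall>a\<in>(\<langle>$\<rangle>) \<pi> ` S. \<sigma> \<langle>$\<rangle> a = a"
  have "\<forall>a\<in>S. (inverse \<pi> * (\<sigma> * \<pi>)) \<langle>$\<rangle> a = a"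
    using fixed by (simp add: apply_times apply_inverse bij_is_inj[OF bij_apply])
  then have "\<phi> (inverse \<pi> * (\<sigma> * \<pi>)) x = x"
    using S by (auto simp: supports_def)
  then have "\<phi> \<pi> x = \<phi> (\<pi> * (inverse \<pi> * (\<sigma> * \<pi>))) x"
    using nominal_set_action[OF X] by metis
  also have "\<pi> * (inverse \<pi> * (\<sigma> * \<pi>)) = \<sigma> * \<pi>"
    by (metis mult.assoc mult_1 perm.right_inverse)
  finally show "\<phi> \<sigma> (\<phi> \<pi> x) = \<phi> \<pi> x"
    using nominal_set_action[OF X] by metis
qed

text \<open>Translating one support along an orbit does not enlarge it, so each orbit has its own
  bound, and only finitely many bounds have to be combined.\<close>

lemma orbit_finite_bounded_support:
  fixes \<phi> :: "('v, 'x) action"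
  assumes X: "nominal_set X \<phi>" and fin: "orbit_finite X \<phi>"
  obtains k where "\<And>x. x \<in> X \<Longrightarrow> \<exists>S. finite S \<and> card S \<le> k \<and> supports \<phi> S x"
proof -
  have "\<exists>k. \<forall>x\<in>Y. \<exists>S. finite S \<and> card S \<le> k \<and> supports \<phi> S x"
    if "Y \<in> orbits perm_group X \<phi>" for Y
  proof -
    obtain x where x: "x \<in> X" "Y = orbit perm_group \<phi> x"
      using \<open>Y \<in> orbits perm_group X \<phi>\<close> unfolding orbits_def by blast
    obtain S where S: "finite S" "supports \<phi> S x"
      using X x(1) by (auto simp: nominal_set_def)
    have "\<exists>S'. finite S' \<and> card S' \<le> card S \<and> supports \<phi> S' y" if "y \<in> Y" for y
    proof -
      obtain \<pi> where "y = \<phi> \<pi> x"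
        using \<open>y \<in> Y\<close> x(2) by (auto simp: orbit_perm_group)
      then show ?thesis
        using supports_image[OF X x(1) S(2), of \<pi>] S(1) card_image_le by blast
    qed
    then show ?thesis by blast
  qed
  then obtain f where f: "\<And>Y x. Y \<in> orbits perm_group X \<phi> \<Longrightarrow> x \<in> Y \<Longrightarrow>
      \<exists>S. finite S \<and> card S \<le> f Y \<and> supports \<phi> S x"
    by metis
  show ?thesis
  \<comment> \<open>The sum dominates each of the finitely many bounds and, unlike a maximum, needs
    no case distinction when there are no orbits.\<close>
  proof (rule that[of "sum f (orbits perm_group X \<phi>)"])
    fix x assume x: "x \<in> X"
    let ?Y = "orbit perm_group \<phi> x"
    have Y: "?Y \<in> orbits perm_group X \<phi>"
      using x unfolding orbits_def by blast
    moreover have "x \<in> ?Y"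
      using nominal_set_action(2)[OF X x] unfolding orbit_perm_group by (metis rangeI)
    moreover have "f ?Y \<le> sum f (orbits perm_group X \<phi>)"
      using fin Y by (intro member_le_sum) (auto simp: orbit_finite_def)
    ultimately show "\<exists>S. finite S \<and> card S \<le> sum f (orbits perm_group X \<phi>) \<and> supports \<phi> S x"
      using f by (meson order_trans)
  qed
qed

section \<open>Equivariance of acceptance and splitting of accepting runs\<close>

lemma equivariantD:
  assumes "equivariant \<phi> U" "x \<in> U"
  shows "\<phi> \<pi> x \<in> U"
  using assms unfolding equivariant_def by blast

lemma accepts_from_equivariant:
  assumes A: "nominal_automaton A" and "accepts_from A w q"
  shows "accepts_from A (map (alphabet_act A \<pi>) w) (states_act A \<pi> q)"
  using assms(2)
proof (induction w arbitrary: q)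
  case Nil
  have "equivariant (states_act A) (final A)"
    using A by (simp add: nominal_automaton_def)
  then show ?case
    using Nil equivariantD by fastforce
next
  case (Cons a w)
  then obtain q' where q': "(q, a, q') \<in> trans_rel A" "accepts_from A w q'" by auto
  have "equivariant (trans_act A) (trans_rel A)"
    using A by (simp add: nominal_automaton_def)
  then have "trans_act A \<pi> (q, a, q') \<in> trans_rel A"
    using q'(1) by (rule equivariantD)
  then show ?case
    using Cons.IH[OF q'(2)] by (auto simp: trans_act_def)
qed

text \<open>Transfers the bound from states to their languages: a permutation that fixes a support
  of \<open>q\<close> fixes \<open>q\<close>, so by equivariance of acceptance it maps the language
  from \<open>q\<close> into itself.\<close>

lemma language_from_bounded_support:
  assumes A: "nominal_automaton A"
  obtains k where "\<And>q. q \<in> states A \<Longrightarrow> \<exists>S. finite S \<and> card S \<le> k \<and>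
    (\<forall>\<pi> w. (\<forall>a\<in>S. \<pi> \<langle>$\<rangle> a = a) \<longrightarrow> w \<in> language_from A q \<longrightarrow>
      map (alphabet_act A \<pi>) w \<in> language_from A q)"
proof -
  obtain k where "\<And>q. q \<in> states A \<Longrightarrow>
      \<exists>S. finite S \<and> card S \<le> k \<and> supports (states_act A) S q"
    using A orbit_finite_bounded_support unfolding nominal_automaton_def by metis
  moreover have "map (alphabet_act A \<pi>) w \<in> language_from A q"
    if "supports (states_act A) S q" "\<forall>a\<in>S. \<pi> \<langle>$\<rangle> a = a" "w \<in> language_from A q" for q S \<pi> w
    using that accepts_from_equivariant[OF A, of w q \<pi>] by (simp add: supports_def language_from_def)
  ultimately show ?thesis
    by (intro that[of k]) metis
qed

text \<open>The witness is the state in which an accepting run on \<open>u @ v\<close> stands after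
  reading \<open>u\<close>.\<close>

lemma accepts_from_append:
  assumes "trans_rel A \<subseteq> states A \<times> alphabet A \<times> states A" "q \<in> states A"
    and "accepts_from A (u @ v) q"
  shows "\<exists>q'\<in>states A. accepts_from A v q' \<and>
    (\<forall>v'. accepts_from A v' q' \<longrightarrow> accepts_from A (u @ v') q)"
  using assms(2,3)
proof (induction u arbitrary: q)
  case (Cons a u)
  then obtain q1 where q1: "(q, a, q1) \<in> trans_rel A" "accepts_from A (u @ v) q1" by auto
  then have "q1 \<in> states A" using assms(1) by auto
  from Cons.IH[OF this q1(2)] show ?case using q1(1) by auto
qed auto

text \<open>Only an inclusion is available: in a nondeterministic automaton \<open>u\<close> may
  lead to several states, and the quotient by \<open>u\<close> is the union of their
  languages.\<close>

lemma state_after_prefix: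
  assumes A: "nominal_automaton A" and "u @ v \<in> language A"
  obtains q where "q \<in> states A" "v \<in> language_from A q"
    "language_from A q \<subseteq> left_quotient u (language A)"
proof -
  obtain q0 where q0: "q0 \<in> initial A" "accepts_from A (u @ v) q0"
    using assms(2) by (auto simp: language_def language_from_def)
  have "trans_rel A \<subseteq> states A \<times> alphabet A \<times> states A" "q0 \<in> states A"
    using A q0(1) by (auto simp: nominal_automaton_def)
  from accepts_from_append[OF this q0(2)] obtain q where "q \<in> states A" "accepts_from A v q"
    "\<forall>v'. accepts_from A v' q \<longrightarrow> accepts_from A (u @ v') q0" by blast
  then show ?thesis
    using q0(1) by (intro that[of q]) (auto simp: language_def language_from_def left_quotient_def)
qed

text \<open>
  A state with a support smaller than the finite set of excluded atoms cannot tell some excluded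
  atom from a fresh one.
\<close>

lemma not_accepted_by_residual:
  fixes \<rho> :: "('v::infinite, 's) action" and Q :: "'q itself"
  assumes t: "\<And>\<pi> a. map (\<rho> \<pi>) (t a) = t (\<pi> \<langle>$\<rangle> a)"
    and L: "\<And>n. \<exists>u v. u @ v \<in> L \<and> (\<forall>w. v \<in> left_quotient w L \<longrightarrow>
      left_quotient w L \<subseteq> left_quotient u L \<longrightarrow>
      finite {a. t a \<notin> left_quotient w L} \<and> n < card {a. t a \<notin> left_quotient w L})"
  shows "\<not> accepted_by Q residual UNIV \<rho> L"
proof
  assume "accepted_by Q residual UNIV \<rho> L"
  then obtain A :: "('v, 's, 'q) nominal_aut" where A: "nominal_automaton A" "residual A"
    "alphabet_act A = \<rho>" "language A = L"
    unfolding accepted_by_def by blast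
  obtain k where k: "\<And>q. q \<in> states A \<Longrightarrow> \<exists>S. finite S \<and> card S \<le> k \<and>
    (\<forall>\<pi> w. (\<forall>a\<in>S. \<pi> \<langle>$\<rangle> a = a) \<longrightarrow> w \<in> language_from A q \<longrightarrow> map (\<rho> \<pi>) w \<in> language_from A q)"
    using language_from_bounded_support[OF A(1)] A(3) by metis
  obtain u v where uv: "u @ v \<in> L" "\<And>w. v \<in> left_quotient w L \<Longrightarrow>
      left_quotient w L \<subseteq> left_quotient u L \<Longrightarrow>
      finite {a. t a \<notin> left_quotient w L} \<and> k < card {a. t a \<notin> left_quotient w L}"
    using L[of k] by blast
  obtain q where q: "q \<in> states A" "v \<in> language_from A q" "language_from A q \<subseteq> left_quotient u L"
    using state_after_prefix[OF A(1)] uv(1) A(4) by metis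
  obtain w where w: "language_from A q = left_quotient w L"
    using A(2,4) q(1) by (auto simp: residual_def)
  \<comment> \<open>The words \<open>t a\<close> serve as tests, and \<open>?X\<close> collects the
    atoms whose test fails. Being larger than the support bound, \<open>?X\<close> has an atom
    outside \<open>S\<close>; being finite, it leaves an atom outside \<open>S\<close> whose test
    succeeds.\<close>
  let ?X = "{a. t a \<notin> language_from A q}"
  have X: "finite ?X" "k < card ?X"
    using uv(2)[of w] q w by auto
  obtain S where S: "finite S" "card S \<le> k"
    "\<And>\<pi> w. \<forall>a\<in>S. \<pi> \<langle>$\<rangle> a = a \<Longrightarrow> w \<in> language_from A q \<Longrightarrow> map (\<rho> \<pi>) w \<in> language_from A q"
    using k[OF q(1)] by blast
  have "\<not> ?X \<subseteq> S"
    using card_mono[OF S(1)] S(2) X(2) by (meson leD order_trans)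
  then obtain a where a: "a \<in> ?X" "a \<notin> S" by blast
  obtain b where b: "b \<notin> ?X \<union> S"
    using ex_new_if_finite[OF infinite_UNIV] X(1) S(1) by (metis finite_UnI)
  \<comment> \<open>This swap preserves the language from \<open>q\<close>, yet it turns the
    accepted test \<open>t b\<close> into the rejected test \<open>t a\<close>.\<close>
  have "\<forall>c\<in>S. Perm.swap b a \<langle>$\<rangle> c = c"
  proof
    fix c assume "c \<in> S"
    then have "c \<noteq> a" "c \<noteq> b" using a(2) b by auto
    then show "Perm.swap b a \<langle>$\<rangle> c = c" by simp
  qed
  then have "map (\<rho> (Perm.swap b a)) (t b) \<in> language_from A q"
    using S(3) b by blast
  then show False using a(1) by (simp add: t)
qed

lemma infinite_UNIV_obtain_distinct:
  obtains u :: "'a::infinite list" where "distinct u" "length u = n"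
proof -
  obtain B :: "'a set" where "finite B" "card B = n"
    using infinite_arbitrarily_large[OF infinite_UNIV] by blast
  then show ?thesis
    using finite_distinct_list[of B] that distinct_card by metis
qed

subsection \<open>Constructing nominal automata\<close>

text \<open>An orbit is determined by any of its elements, so finitely many representatives that
  reach every element account for all orbits.\<close>

lemma orbit_finiteI:
  fixes \<phi> :: "('v, 'x) action"
  assumes X: "nominal_set X \<phi>" and R: "finite R" "R \<subseteq> X"
    and cover: "\<And>x. x \<in> X \<Longrightarrow> \<exists>r\<in>R. \<exists>\<pi>. x = \<phi> \<pi> r"
  shows "orbit_finite X \<phi>"
proof -
  have "orbits perm_group X \<phi> \<subseteq> orbit perm_group \<phi> ` R"
  proof
    fix Y assume "Y \<in> orbits perm_group X \<phi>"
    then obtain x where x: "x \<in> X" "Y = orbit perm_group \<phi> x"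
      unfolding orbits_def by blast
    obtain r \<pi> where r: "r \<in> R" "x = \<phi> \<pi> r"
      using cover x(1) by blast
    have r_X: "r \<in> X" using r(1) R(2) by blast
    have comp: "\<phi> \<sigma> x = \<phi> (\<sigma> * \<pi>) r" for \<sigma>
      unfolding r(2) nominal_set_action(3)[OF X r_X] ..
    have "\<phi> \<sigma> r = \<phi> (\<sigma> * inverse \<pi>) x" for \<sigma>
      unfolding comp by (simp add: mult.assoc)
    then have "orbit perm_group \<phi> x = orbit perm_group \<phi> r"
      unfolding orbit_perm_group using comp by blast
    then show "Y \<in> orbit perm_group \<phi> ` R"
      using r(1) x(2) by blast
  qed
  then show ?thesis
    unfolding orbit_finite_def using R(1) by (meson finite_imageI finite_subset)
qed

lemma nominal_set_UNIVI:
  assumes "\<And>x. \<phi> 1 x = x" "\<And>\<pi> \<sigma> x. \<phi> (\<pi> * \<sigma>) x = \<phi> \<pi> (\<phi> \<sigma> x)"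
    and "\<And>x. \<exists>S. finite S \<and> supports \<phi> S x"
  shows "nominal_set UNIV \<phi>"
  using assms by (simp add: nominal_set_def group_action_perm_iff)

text \<open>Closure gives one inclusion for every permutation; the reverse inclusion is closure
  under the inverse permutation.\<close>

lemma equivariantI:
  assumes "\<And>x. \<phi> 1 x = x" "\<And>\<pi> \<sigma> x. \<phi> (\<pi> * \<sigma>) x = \<phi> \<pi> (\<phi> \<sigma> x)"
    and closed: "\<And>\<pi> x. x \<in> U \<Longrightarrow> \<phi> \<pi> x \<in> U"
  shows "equivariant \<phi> U"
  unfolding equivariant_def
proof (intro allI equalityI subsetI)
  fix \<pi> x assume x: "x \<in> U"
  have "x = \<phi> \<pi> (\<phi> (inverse \<pi>) x)"
    using assms(1,2) by (metis perm.right_inverse)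
  then show "x \<in> \<phi> \<pi> ` U"
    using closed[OF x] by blast
qed (use closed in blast)

lemma nominal_automaton_UNIVI:
  fixes \<rho> :: "('v, 's) action" and \<phi> :: "('v, 'q) action"
  assumes \<rho>: "nominal_set UNIV \<rho>" "orbit_finite UNIV \<rho>"
    and \<phi>: "nominal_set UNIV \<phi>" "orbit_finite UNIV \<phi>"
    and I: "\<And>\<pi> q. q \<in> I \<Longrightarrow> \<phi> \<pi> q \<in> I"
    and F: "\<And>\<pi> q. q \<in> F \<Longrightarrow> \<phi> \<pi> q \<in> F"
    and T: "\<And>\<pi> q a q'. (q, a, q') \<in> T \<Longrightarrow> (\<phi> \<pi> q, \<rho> \<pi> a, \<phi> \<pi> q') \<in> T"
  shows "nominal_automaton \<lparr>alphabet = UNIV, alphabet_act = \<rho>, states = UNIV, states_act = \<phi>,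
    initial = I, final = F, trans_rel = T\<rparr>" (is "nominal_automaton ?A")
proof -
  note act = nominal_set_action(2,3)[OF \<rho>(1) UNIV_I] nominal_set_action(2,3)[OF \<phi>(1) UNIV_I]
  have "equivariant \<phi> I" "equivariant \<phi> F"
    by (rule equivariantI; simp add: act I F)+
  moreover have "equivariant (trans_act ?A) T"
    by (rule equivariantI) (auto simp: trans_act_def act T)
  ultimately show ?thesis
    using \<rho> \<phi> by (simp add: nominal_automaton_def)
qed

lemma accepted_byI:
  fixes A :: "('v, 's, 'q) nominal_aut"
  assumes "nominal_automaton A" "P A" "alphabet A = \<Sigma>" "alphabet_act A = \<rho>" "language A = L"
  shows "accepted_by TYPE('q) P \<Sigma> \<rho> L"
  using assms unfolding accepted_by_def by blast

lemma accepted_by_mono: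
  assumes "accepted_by T P \<Sigma> \<rho> L" "\<And>A. P A \<Longrightarrow> P' A"
  shows "accepted_by T P' \<Sigma> \<rho> L"
  using assms unfolding accepted_by_def by blast


subsection \<open>Orbit-finite nominal sets\<close>

text \<open>State space shared by the automata for \<open>L_r\<close>, \<open>first_fresh\<close>
  and \<open>some_repeated\<close>. One stored atom suffices for all three; \<open>Done\<close> is
  where \<open>Holds a\<close> goes on reading the atom \<open>a\<close> again or as the announced
  last letter.\<close>

datatype 'v register = Blank | Holds 'v | Done

definition register_act :: "('v, 'v register) action" where
  "register_act \<pi> = map_register (atom_act \<pi>)"

lemma atom_act_simps [simp]:
  "atom_act 1 a = a"
  "atom_act (\<pi> * \<sigma>) a = atom_act \<pi> (atom_act \<sigma> a)"
  "atom_act \<pi> a = atom_act \<pi> b \<longleftrightarrow> a = b"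
  "atom_act (Perm.swap a b) a = b"
  by (simp_all add: atom_act_def apply_times inj_eq[OF bij_is_inj[OF bij_apply]])

lemma letter_act_simps [simp]:
  "letter_act \<pi> (Atom a) = Atom (atom_act \<pi> a)"
  "letter_act \<pi> (Anc a) = Anc (atom_act \<pi> a)"
  by (simp_all add: letter_act_def)

lemma register_act_simps [simp]:
  "register_act \<pi> Blank = Blank"
  "register_act \<pi> (Holds a) = Holds (atom_act \<pi> a)"
  "register_act \<pi> Done = Done"
  by (simp_all add: register_act_def)

lemma nominal_set_atom_act: "nominal_set UNIV (atom_act :: ('v, 'v) action)"
proof (rule nominal_set_UNIVI)
  show "\<exists>S. finite S \<and> supports (atom_act :: ('v, 'v) action) S a" for a
    by (rule exI[of _ "{a}"]) (simp add: supports_def atom_act_def)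
qed simp_all

lemma nominal_set_letter_act: "nominal_set UNIV (letter_act :: ('v, 'v letter) action)"
proof (rule nominal_set_UNIVI)
  fix x :: "'v letter" and \<pi> \<sigma> :: "'v perm"
  show "letter_act 1 x = x" "letter_act (\<pi> * \<sigma>) x = letter_act \<pi> (letter_act \<sigma> x)"
    by (cases x; simp)+
  show "\<exists>S. finite S \<and> supports (letter_act :: ('v, 'v letter) action) S x"
    by (rule exI[of _ "set_letter x"], cases x) (simp_all add: supports_def atom_act_def)
qed

lemma nominal_set_register_act: "nominal_set UNIV (register_act :: ('v, 'v register) action)"
proof (rule nominal_set_UNIVI)
  fix x :: "'v register" and \<pi> \<sigma> :: "'v perm"
  show "register_act 1 x = x" "register_act (\<pi> * \<sigma>) x = register_act \<pi> (register_act \<sigma> x)"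
    by (cases x; simp)+
  show "\<exists>S. finite S \<and> supports (register_act :: ('v, 'v register) action) S x"
    by (rule exI[of _ "set_register x"], cases x) (simp_all add: supports_def atom_act_def)
qed

lemma orbit_finite_atom_act: "orbit_finite UNIV (atom_act :: ('v, 'v) action)"
proof (rule orbit_finiteI[OF nominal_set_atom_act])
  fix a :: 'v
  \<comment> \<open>The atoms form a single orbit, since a swap carries any atom to any other;
    \<open>undefined\<close> is an arbitrary representative.\<close>
  show "\<exists>r\<in>{undefined}. \<exists>\<pi>. a = atom_act \<pi> r"
    by (metis atom_act_simps(4) singletonI)
qed simp_all

lemma orbit_finite_letter_act: "orbit_finite UNIV (letter_act :: ('v, 'v letter) action)"
proof (rule orbit_finiteI[OF nominal_set_letter_act])
  fix x :: "'v letter"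
  have "\<exists>\<pi>. x = letter_act \<pi> (Atom undefined) \<or> x = letter_act \<pi> (Anc undefined)"
    by (cases x) (metis atom_act_simps(4) letter_act_simps)+
  then show "\<exists>r\<in>{Atom undefined, Anc undefined}. \<exists>\<pi>. x = letter_act \<pi> r"
    by blast
qed simp_all

lemma orbit_finite_register_act: "orbit_finite UNIV (register_act :: ('v, 'v register) action)"
proof (rule orbit_finiteI[OF nominal_set_register_act])
  fix x :: "'v register"
  have "\<exists>\<pi>. x = register_act \<pi> Blank \<or> x = register_act \<pi> (Holds undefined) \<or> x = register_act \<pi> Done"
    by (cases x) (metis atom_act_simps(4) register_act_simps)+
  then show "\<exists>r\<in>{Blank, Holds undefined, Done}. \<exists>\<pi>. x = register_act \<pi> r"
    by blast
qed simp_all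

lemmas atom_automatonI = nominal_automaton_UNIVI
  [OF nominal_set_atom_act orbit_finite_atom_act nominal_set_register_act orbit_finite_register_act]
lemmas letter_automatonI = nominal_automaton_UNIVI
  [OF nominal_set_letter_act orbit_finite_letter_act nominal_set_register_act orbit_finite_register_act]


subsection \<open>Accepting automata\<close>

text \<open>Splits the nonempty words of \<open>L_r\<close> by their last letter. It is the language
  from the state \<open>Holds a\<close> and also the quotient of \<open>L_r\<close> by
  \<open>[Anc a]\<close>.\<close>

definition anchored :: "'v \<Rightarrow> 'v letter list set" where
  "anchored a = {w @ [Atom a] | w. w \<in> lists (Atom ` (UNIV - {a}) \<union> {Anc a})}"

lemma L_r_anchored: "L_r = (\<Union>a. anchored a) \<union> {[]}"
  by (auto simp: L_r_def anchored_def)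

text \<open>These are the one-letter quotients, in the same shape as the transitions out of
  \<open>Holds a\<close>, so that acceptance and membership can be compared by induction.\<close>

lemma anchored_simps [simp]:
  "[] \<notin> anchored a"
  "Atom b # w \<in> anchored a \<longleftrightarrow> (if b = a then w = [] else w \<in> anchored a)"
  "Anc b # w \<in> anchored a \<longleftrightarrow> b = a \<and> w \<in> anchored a"
  by (auto simp: anchored_def Cons_eq_append_conv)

lemma append_Atom_in_L_r:
  "u @ [Atom a] \<in> L_r \<longleftrightarrow> u \<in> lists (Atom ` (UNIV - {a}) \<union> {Anc a})"
  by (auto simp: L_r_def)

lemma accepted_L_r:
  "accepted_by TYPE(nat) residual UNIV (letter_act :: ('v::{countable, infinite}, 'v letter) action) L_r"
proof -
  let ?T = "{(Holds a, Atom b, Holds a) | a b :: 'v. a \<noteq> b} \<union> {(Holds a, Anc a, Holds a) | a. True} \<union>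
    {(Holds a, Atom a, Done) | a. True}"
  \<comment> \<open>The automaton guesses the last atom at the start and checks every letter against
    it. \<open>Done\<close> is initial as well, in order to accept the empty word.
    \<open>Blank\<close> has no transitions, so the empty language must be a quotient too.\<close>
  define A :: "('v, 'v letter, 'v register) nominal_aut" where
    "A = \<lparr>alphabet = UNIV, alphabet_act = letter_act, states = UNIV, states_act = register_act,
      initial = range Holds \<union> {Done}, final = {Done}, trans_rel = ?T\<rparr>"
  have A: "nominal_automaton A"
    unfolding A_def by (rule letter_automatonI) auto
  have ended: "language_from A Done = {[]}"
  proof -
    have "accepts_from A w Done \<longleftrightarrow> w = []" for w
      by (cases w) (auto simp: A_def)
    then show ?thesis by (auto simp: language_from_def)
  qed
  have blank: "language_from A Blank = {}"
  proof -
    have "\<not> accepts_from A w Blank" for w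
      by (cases w) (auto simp: A_def)
    then show ?thesis by (auto simp: language_from_def)
  qed
  have holds: "language_from A (Holds a) = anchored a" for a
  proof -
    have "accepts_from A w (Holds a) \<longleftrightarrow> w \<in> anchored a" for w
    proof (induction w)
      case Nil
      show ?case by (simp add: A_def)
    next
      case (Cons x w)
      have "accepts_from A w Done \<longleftrightarrow> w = []"
        using ended by (auto simp: language_from_def)
      then show ?case
        using Cons.IH by (cases x) (auto simp: A_def)
    qed
    then show ?thesis by (auto simp: language_from_def)
  qed
  have lang: "language A = L_r"
  proof -
    have "language A = (\<Union>a. language_from A (Holds a)) \<union> language_from A Done"
      by (auto simp: language_def A_def)
    then show ?thesis by (simp add: holds ended L_r_anchored)
  qed
  have alph: "alphabet A = UNIV" "alphabet_act A = letter_act"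
    by (simp_all add: A_def)
  have "residual A"
    unfolding residual_def lang
  proof
    fix q
    obtain a b :: 'v where "a \<noteq> b"
      using ex_new_if_finite[OF infinite_UNIV, of "{undefined}"] by auto
    then show "\<exists>w\<in>lists (alphabet A). language_from A q = left_quotient w L_r"
    proof (cases q)
      \<comment> \<open>No word of \<open>L_r\<close> contains two different anchors.\<close>
      case Blank
      then show ?thesis
        using \<open>a \<noteq> b\<close>
        by (intro bexI[of _ "[Anc a, Anc b]"]) (auto simp: blank left_quotient_def L_r_anchored alph)
    next
      \<comment> \<open>Reading an anchor reveals the guess: only runs that started in
        \<open>Holds c\<close> survive \<open>Anc c\<close>. This is what makes the automaton
        residual.\<close>
      case (Holds c)
      then show ?thesis
        by (intro bexI[of _ "[Anc c]"]) (auto simp: holds left_quotient_def L_r_anchored alph)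
    next
      \<comment> \<open>After \<open>Anc a\<close> the guess must be \<open>a\<close>, so the
        following \<open>Atom a\<close> has to end the word.\<close>
      case Done
      then show ?thesis
        by (intro bexI[of _ "[Anc a, Atom a]"]) (auto simp: ended left_quotient_def L_r_anchored alph)
    qed
  qed
  then show ?thesis
    using A lang alph by (intro accepted_by_nat(1)[OF accepted_byI[of A]]) simp_all
qed

lemma accepted_L_2:
  "accepted_by TYPE(nat) (\<lambda>A. deterministic A \<and> residual A) UNIV
    (letter_act :: ('v::{countable, infinite}, 'v letter) action) L_2"
proof -
  \<comment> \<open>The state records whether only atoms have been read so far. No particular atom
    is remembered, so permutations act trivially on states.\<close>
  define A :: "('v, 'v letter, bool) nominal_aut" where
    "A = \<lparr>alphabet = UNIV, alphabet_act = letter_act, states = UNIV, states_act = \<lambda>_ q. q,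
      initial = {True}, final = {True}, trans_rel = {(q, x, q \<and> x \<in> range Atom) | q x. True}\<rparr>"
  have bool: "nominal_set UNIV (\<lambda>_ q. q :: bool)"
    by (rule nominal_set_UNIVI) (auto simp: supports_def)
  have A: "nominal_automaton A"
    unfolding A_def
  proof (rule nominal_automaton_UNIVI[OF nominal_set_letter_act orbit_finite_letter_act bool])
    show "orbit_finite UNIV (\<lambda>(_ :: 'v perm) q. q :: bool)"
      by (rule orbit_finiteI[OF bool, of UNIV]) auto
    have "letter_act \<pi> x \<in> range Atom \<longleftrightarrow> x \<in> range Atom" for \<pi> and x :: "'v letter"
      by (cases x) auto
    then show "(q, letter_act \<pi> x, q') \<in> {(q, x, q \<and> x \<in> range Atom) | q x. True}"
      if "(q, x, q') \<in> {(q, x, q \<and> x \<in> range Atom) | q x. True}" for \<pi> q q' and x :: "'v letter"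
      using that by auto
  qed auto
  have acc: "accepts_from A w q \<longleftrightarrow> q \<and> w \<in> L_2" for w q
    by (induction w arbitrary: q) (auto simp: A_def L_2_def)
  then have lang: "language A = L_2"
    by (auto simp: language_def language_from_def A_def)
  have alph: "alphabet A = UNIV" "alphabet_act A = letter_act"
    by (simp_all add: A_def)
  have "residual A"
    unfolding residual_def lang
  proof
    fix q
    show "\<exists>w\<in>lists (alphabet A). language_from A q = left_quotient w L_2"
      by (rule bexI[of _ "if q then [] else [Anc undefined]"])
        (auto simp: language_from_def left_quotient_def acc alph L_2_def)
  qed
  moreover have "deterministic A"
    by (auto simp: deterministic_def A_def)
  ultimately show ?thesis
    using A lang alph by (intro accepted_by_nat(2)[OF accepted_byI[of A]]) simp_all
qed

section \<open>Automata over the alphabet of atoms alone\<close>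

lemma accepted_first_fresh:
  "accepted_by TYPE(nat) (\<lambda>A. deterministic A \<and> residual A) UNIV
    (atom_act :: ('v::{countable, infinite}, 'v) action) first_fresh"
proof -
  let ?T = "{(Blank, a, Holds a) | a :: 'v. True} \<union> {(Holds a, b, Holds a) | a b. a \<noteq> b} \<union>
    {(Holds a, a, Done) | a. True} \<union> {(Done, a, Done) | a. True}"
  \<comment> \<open>The first letter is stored and never changed. \<open>Done\<close> is a rejecting
    sink that makes the transition relation total; it is reached by any word
    \<open>[a, a]\<close>.\<close>
  define A :: "('v, 'v, 'v register) nominal_aut" where
    "A = \<lparr>alphabet = UNIV, alphabet_act = atom_act, states = UNIV, states_act = register_act,
      initial = {Blank}, final = range Holds, trans_rel = ?T\<rparr>"
  have A: "nominal_automaton A"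
    unfolding A_def by (rule atom_automatonI) auto
  have ended: "\<not> accepts_from A w Done" for w
    by (induction w) (auto simp: A_def)
  have holds: "accepts_from A w (Holds a) \<longleftrightarrow> a \<notin> set w" for w a
  proof (induction w)
    case (Cons b w)
    then show ?case using ended[of w] by (auto simp: A_def)
  qed (simp add: A_def)
  have blank: "accepts_from A w Blank \<longleftrightarrow> w \<in> first_fresh" for w
  proof (cases w)
    case (Cons b v)
    then show ?thesis using holds[of v] by (auto simp: A_def first_fresh_def)
  qed (auto simp: A_def first_fresh_def)
  have lang: "language A = first_fresh"
    using blank by (auto simp: language_def language_from_def A_def)
  have alph: "alphabet A = UNIV" "alphabet_act A = atom_act"
    by (simp_all add: A_def)
  have "residual A"
    unfolding residual_def lang
  proof
    fix q
    show "\<exists>w\<in>lists (alphabet A). language_from A q = left_quotient w first_fresh"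
    proof (cases q)
      case Blank
      then show ?thesis
        by (intro bexI[of _ "[]"]) (auto simp: blank left_quotient_def language_from_def alph)
    next
      case (Holds a)
      then show ?thesis
        by (intro bexI[of _ "[a]"])
          (auto simp: holds left_quotient_def language_from_def first_fresh_def alph)
    next
      case Done
      then show ?thesis
        by (intro bexI[of _ "[undefined, undefined]"])
          (auto simp: ended left_quotient_def language_from_def first_fresh_def alph)
    qed
  qed
  moreover have "deterministic A"
    unfolding deterministic_def
  proof (intro conjI ballI)
    fix q a
    show "\<exists>!q'. (q, a, q') \<in> trans_rel A"
      by (cases q) (auto simp: A_def)
  qed (simp add: A_def)
  ultimately show ?thesis
    using A lang alph by (intro accepted_by_nat(2)[OF accepted_byI[of A]]) simp_all
qed

lemma some_repeated_eq: "some_repeated = {w. \<not> distinct w}"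
  by (force simp: some_repeated_def dest: not_distinct_decomp)

text \<open>The stored atom may be replaced by the current letter at any time, so
  \<open>Holds a\<close> accepts \<open>w\<close> exactly if \<open>a # w\<close> has a repetition,
  which is the quotient by \<open>[a]\<close>. If the stored atom were kept for good,
  \<open>Holds a\<close> would accept the words containing \<open>a\<close>; that is not a quotient,
  because every quotient contains all words with a repetition.\<close>

lemma accepted_some_repeated:
  "accepted_by TYPE(nat) residual UNIV (atom_act :: ('v::{countable, infinite}, 'v) action) some_repeated"
proof -
  let ?T = "{(Blank, a, Holds a) | a :: 'v. True} \<union> {(Holds a, b, Holds c) | a b c. c = a \<or> c = b} \<union>
    {(Holds a, a, Done) | a. True} \<union> {(Done, a, Done) | a. True}"
  define A :: "('v, 'v, 'v register) nominal_aut" where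
    "A = \<lparr>alphabet = UNIV, alphabet_act = atom_act, states = UNIV, states_act = register_act,
      initial = {Blank}, final = {Done}, trans_rel = ?T\<rparr>"
  have A: "nominal_automaton A"
    unfolding A_def by (rule atom_automatonI) auto
  have ended: "accepts_from A w Done" for w
    by (induction w) (auto simp: A_def)
  have holds: "accepts_from A w (Holds a) \<longleftrightarrow> \<not> distinct (a # w)" for w a
  proof (induction w arbitrary: a)
    case (Cons b w)
    have "accepts_from A (b # w) (Holds a) \<longleftrightarrow>
        accepts_from A w (Holds a) \<or> accepts_from A w (Holds b) \<or> a = b"
      using ended[of w] by (auto simp: A_def)
    then show ?case using Cons.IH by auto
  qed (simp add: A_def)
  have blank: "accepts_from A w Blank \<longleftrightarrow> \<not> distinct w" for w
  proof (cases w)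
    case (Cons b v)
    then show ?thesis using holds[of v] by (auto simp: A_def)
  qed (auto simp: A_def)
  have lang: "language A = some_repeated"
    using blank by (auto simp: language_def language_from_def A_def some_repeated_eq)
  have alph: "alphabet A = UNIV" "alphabet_act A = atom_act"
    by (simp_all add: A_def)
  have "residual A"
    unfolding residual_def lang some_repeated_eq
  proof
    fix q
    show "\<exists>w\<in>lists (alphabet A). language_from A q = left_quotient w {w. \<not> distinct w}"
    proof (cases q)
      case Blank
      then show ?thesis
        by (intro bexI[of _ "[]"]) (auto simp: blank left_quotient_def language_from_def alph)
    next
      case (Holds a)
      then show ?thesis
        by (intro bexI[of _ "[a]"]) (auto simp: holds left_quotient_def language_from_def alph)
    next
      case Done
      then show ?thesis
        by (intro bexI[of _ "[undefined, undefined]"])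
          (auto simp: ended left_quotient_def language_from_def alph)
    qed
  qed
  then show ?thesis
    using A lang alph by (intro accepted_by_nat(1)[OF accepted_byI[of A]]) simp_all
qed


subsection \<open>Languages without residual automata\<close>

text \<open>Counting step shared by union and intersection: the failing tests will correspond to the
  atoms of \<open>w\<close>, finitely many because \<open>w\<close> is a list, and more than
  \<open>n\<close> because they include the \<open>Suc n\<close> atoms of \<open>u\<close>.\<close>

lemma finite_large_atoms:
  fixes w :: "'v letter list"
  assumes "distinct u" "length u = Suc n" "\<And>a. a \<in> set u \<Longrightarrow> Atom a \<in> set w"
  shows "finite {a. Atom a \<in> set w} \<and> n < card {a. Atom a \<in> set w}"
proof
  show fin: "finite {a. Atom a \<in> set w}"
    using finite_vimageI[of "set w" Atom] by (simp add: vimage_def inj_def)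
  have "card (set u) \<le> card {a. Atom a \<in> set w}"
    using assms(3) by (intro card_mono[OF fin]) blast
  then show "n < card {a. Atom a \<in> set w}"
    using assms(1,2) by (simp add: distinct_card)
qed

text \<open>Without anchors in \<open>w\<close>, the only remaining constraint imposed by
  \<open>L_r\<close> is that \<open>a\<close> has not occurred.\<close>

lemma in_lists_anchor_iff:
  assumes "w \<in> lists (range Atom)"
  shows "w \<in> lists (Atom ` (UNIV - {a}) \<union> {Anc a}) \<longleftrightarrow> Atom a \<notin> set w"
  using assms by auto

text \<open>The anchor in the test \<open>[Anc a, Atom a]\<close> rules out \<open>L_2\<close>, so
  on an anchor-free prefix the test succeeds exactly for atoms not yet read. A quotient below that
  of \<open>u\<close> must then fail for every atom of \<open>u\<close>.\<close>

lemma not_accepted_union: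
  "\<not> accepted_by Q residual UNIV (letter_act :: ('v::infinite, 'v letter) action) (L_r \<union> L_2)"
proof (rule not_accepted_by_residual)
  show "map (letter_act \<pi>) [Anc a, Atom a] = [Anc (\<pi> \<langle>$\<rangle> a), Atom (\<pi> \<langle>$\<rangle> a)]" for \<pi> and a :: 'v
    by (simp add: atom_act_def)
  let ?L = "L_r \<union> L_2 :: 'v letter list set"
  have test: "[Anc a, Atom a] \<in> left_quotient w ?L \<longleftrightarrow> Atom a \<notin> set w"
    if "w \<in> lists (range Atom)" for a w
    using append_Atom_in_L_r[of "w @ [Anc a]" a] in_lists_anchor_iff[OF that, of a]
    by (auto simp: left_quotient_def L_2_def)
  fix n
  obtain u :: "'v list" where u: "distinct u" "length u = Suc n"
    using infinite_UNIV_obtain_distinct by blast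
  \<comment> \<open>A word of \<open>L_r\<close> cannot end in the same atom twice, so accepting
    this suffix puts \<open>w @ ?v\<close> into \<open>L_2\<close> and makes \<open>w\<close> free
    of anchors.\<close>
  let ?v = "[Atom undefined, Atom undefined]"
  show "\<exists>u v. u @ v \<in> ?L \<and> (\<forall>w. v \<in> left_quotient w ?L \<longrightarrow>
      left_quotient w ?L \<subseteq> left_quotient u ?L \<longrightarrow>
      finite {a. [Anc a, Atom a] \<notin> left_quotient w ?L} \<and>
      n < card {a. [Anc a, Atom a] \<notin> left_quotient w ?L})"
  proof (rule exI[of _ "map Atom u"], rule exI[of _ ?v], intro conjI allI impI)
    show "map Atom u @ ?v \<in> ?L"
      by (auto simp: L_2_def)
    fix w assume v: "?v \<in> left_quotient w ?L" and sub: "left_quotient w ?L \<subseteq> left_quotient (map Atom u) ?L"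
    have "w \<in> lists (range Atom)"
      using v append_Atom_in_L_r[of "w @ [Atom undefined]" undefined]
      by (auto simp: left_quotient_def L_2_def)
    note test_w = test[OF this]
    have "Atom a \<in> set w" if "a \<in> set u" for a
    proof (rule ccontr)
      assume "Atom a \<notin> set w"
      then have "[Anc a, Atom a] \<in> left_quotient (map Atom u) ?L"
        using test_w sub by blast
      moreover have "map Atom u \<in> lists (range Atom)" by auto
      ultimately show False
        using test that by auto
    qed
    then show "finite {a. [Anc a, Atom a] \<notin> left_quotient w ?L}"
      and "n < card {a. [Anc a, Atom a] \<notin> left_quotient w ?L}"
      using finite_large_atoms[OF u] by (simp_all add: test_w)
  qed
qed

text \<open>Up to the empty word, the intersection consists of the words over atoms whose last
  letter is new. A one-letter test therefore detects which atoms occur in the prefix.\<close>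

lemma not_accepted_inter:
  "\<not> accepted_by Q residual UNIV (letter_act :: ('v::infinite, 'v letter) action) (L_r \<inter> L_2)"
proof (rule not_accepted_by_residual)
  show "map (letter_act \<pi>) [Atom a] = [Atom (\<pi> \<langle>$\<rangle> a)]" for \<pi> and a :: 'v
    by (simp add: atom_act_def)
  let ?L = "L_r \<inter> L_2 :: 'v letter list set"
  have test: "[Atom a] \<in> left_quotient w ?L \<longleftrightarrow> w \<in> lists (range Atom) \<and> Atom a \<notin> set w" for a w
    using append_Atom_in_L_r[of w a] in_lists_anchor_iff[of w a]
    by (auto simp: left_quotient_def L_2_def)
  fix n
  obtain u :: "'v list" where u: "distinct u" "length u = Suc n"
    using infinite_UNIV_obtain_distinct by blast
  \<comment> \<open>A fresh last atom completes \<open>u\<close> to a word of the language; any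
    \<open>w\<close> that also accepts it must be anchor-free.\<close>
  obtain b where b: "b \<notin> set u"
    using ex_new_if_finite[OF infinite_UNIV] by blast
  show "\<exists>u v. u @ v \<in> ?L \<and> (\<forall>w. v \<in> left_quotient w ?L \<longrightarrow>
      left_quotient w ?L \<subseteq> left_quotient u ?L \<longrightarrow>
      finite {a. [Atom a] \<notin> left_quotient w ?L} \<and> n < card {a. [Atom a] \<notin> left_quotient w ?L})"
  proof (rule exI[of _ "map Atom u"], rule exI[of _ "[Atom b]"], intro conjI allI impI)
    show "map Atom u @ [Atom b] \<in> ?L"
      using test[of b "map Atom u"] b by (auto simp: left_quotient_def)
    fix w assume v: "[Atom b] \<in> left_quotient w ?L"
      and sub: "left_quotient w ?L \<subseteq> left_quotient (map Atom u) ?L"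
    have w: "w \<in> lists (range Atom)"
      using v test by blast
    have "Atom a \<in> set w" if "a \<in> set u" for a
    proof (rule ccontr)
      assume "Atom a \<notin> set w"
      then have "[Atom a] \<in> left_quotient (map Atom u) ?L"
        using test w sub by blast
      then show False using that by (simp add: test)
    qed
    then show "finite {a. [Atom a] \<notin> left_quotient w ?L}"
      and "n < card {a. [Atom a] \<notin> left_quotient w ?L}"
      using finite_large_atoms[OF u] w by (simp_all add: test)
  qed
qed

lemma not_accepted_rev_first_fresh:
  "\<not> accepted_by Q residual UNIV (atom_act :: ('v::infinite, 'v) action) (rev ` first_fresh)"
proof (rule not_accepted_by_residual)
  show "map (atom_act \<pi>) [a] = [\<pi> \<langle>$\<rangle> a]" for \<pi> and a :: 'v
    by (simp add: atom_act_def)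
  let ?L = "rev ` first_fresh :: 'v list set"
  have test: "[a] \<in> left_quotient w ?L \<longleftrightarrow> a \<notin> set w" for a w
  proof -
    have "w @ [a] \<in> ?L \<longleftrightarrow> rev (w @ [a]) \<in> first_fresh"
      by (metis (no_types, lifting) imageE imageI rev_rev_ident)
    then show ?thesis by (simp add: left_quotient_def first_fresh_def)
  qed
  fix n
  obtain u :: "'v list" where u: "distinct u" "length u = Suc n"
    using infinite_UNIV_obtain_distinct by blast
  obtain b where b: "b \<notin> set u"
    using ex_new_if_finite[OF infinite_UNIV] by blast
  show "\<exists>u v. u @ v \<in> ?L \<and> (\<forall>w. v \<in> left_quotient w ?L \<longrightarrow>
      left_quotient w ?L \<subseteq> left_quotient u ?L \<longrightarrow>
      finite {a. [a] \<notin> left_quotient w ?L} \<and> n < card {a. [a] \<notin> left_quotient w ?L})"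
  proof (rule exI[of _ u], rule exI[of _ "[b]"], intro conjI allI impI)
    show "u @ [b] \<in> ?L"
      using test[of b u] b by (simp add: left_quotient_def)
    fix w assume sub: "left_quotient w ?L \<subseteq> left_quotient u ?L"
    \<comment> \<open>An atom of \<open>u\<close> missing from \<open>w\<close> would pass the test
      after \<open>w\<close> but not after \<open>u\<close>. The failing tests after
      \<open>w\<close> are exactly the atoms in \<open>set w\<close>.\<close>
    have "set u \<subseteq> set w"
      using sub test by blast
    then have "card (set u) \<le> card (set w)"
      by (simp add: card_mono)
    then show "finite {a. [a] \<notin> left_quotient w ?L}" "n < card {a. [a] \<notin> left_quotient w ?L}"
      using u by (simp_all add: test distinct_card)
  qed
qed

text \<open>Here nothing is known about residuality, so the argument works with the two halves of
  one word: a state in the middle can keep neither all atoms read nor all atoms still to come in its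
  support.\<close>

lemma not_accepted_distinct:
  fixes Q :: "'q itself"
  shows "\<not> accepted_by Q (\<lambda>_. True) UNIV (atom_act :: ('v::infinite, 'v) action) {w. distinct w}"
proof
  assume "accepted_by Q (\<lambda>_. True) UNIV (atom_act :: ('v, 'v) action) {w. distinct w}"
  then obtain A :: "('v, 'v, 'q) nominal_aut" where A: "nominal_automaton A"
    "alphabet_act A = atom_act" "language A = {w. distinct w}"
    unfolding accepted_by_def by blast
  obtain k where k: "\<And>q. q \<in> states A \<Longrightarrow> \<exists>S. finite S \<and> card S \<le> k \<and>
    (\<forall>\<pi> w. (\<forall>a\<in>S. \<pi> \<langle>$\<rangle> a = a) \<longrightarrow> w \<in> language_from A q \<longrightarrow>
      map (alphabet_act A \<pi>) w \<in> language_from A q)"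
    using language_from_bounded_support[OF A(1)] by metis
  \<comment> \<open>Each half needs one atom more than the bound \<open>k\<close>, so that both
    contain an atom outside \<open>S\<close>.\<close>
  obtain x :: "'v list" where x: "distinct x" "length x = Suc k + Suc k"
    using infinite_UNIV_obtain_distinct by blast
  define u v where "u = take (Suc k) x" and "v = drop (Suc k) x"
  have uv: "distinct (u @ v)" "length u = Suc k" "length v = Suc k"
    using x by (simp_all add: u_def v_def)
  obtain q where q: "q \<in> states A" "v \<in> language_from A q"
    "language_from A q \<subseteq> left_quotient u {w. distinct w}"
    using state_after_prefix[OF A(1)] uv(1) A(3) by (metis mem_Collect_eq)
  obtain S where S: "finite S" "card S \<le> k"
    "\<And>\<pi> w. \<forall>a\<in>S. \<pi> \<langle>$\<rangle> a = a \<Longrightarrow> w \<in> language_from A q \<Longrightarrow> map (atom_act \<pi>) w \<in> language_from A q"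
    using k[OF q(1)] A(2) by auto
  have large: "\<not> set y \<subseteq> S" if "distinct y" "length y = Suc k" for y
    using card_mono[OF S(1), of "set y"] S(2) that by (auto simp: distinct_card)
  obtain a b where a: "a \<in> set u" "a \<notin> S" and b: "b \<in> set v" "b \<notin> S"
    using large[of u] large[of v] uv by auto
  have "\<forall>c\<in>S. Perm.swap b a \<langle>$\<rangle> c = c"
  proof
    fix c assume "c \<in> S"
    then have "c \<noteq> a" "c \<noteq> b" using a(2) b(2) by auto
    then show "Perm.swap b a \<langle>$\<rangle> c = c" by simp
  qed
  \<comment> \<open>The swap keeps \<open>v\<close> in the language from \<open>q\<close>, hence in
    the quotient by \<open>u\<close>, but it puts the atom \<open>a\<close> of \<open>u\<close> in
    place of \<open>b\<close>.\<close>
  then have "distinct (u @ map (atom_act (Perm.swap b a)) v)"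
    using S(3) q(2,3) unfolding left_quotient_def by blast
  moreover have "a \<in> set (map (atom_act (Perm.swap b a)) v)"
    using b(1) by (force simp: image_iff)
  ultimately show False using a(1) by auto
qed

lemma not_accepted_by_residual_distinct:
  "\<not> accepted_by Q residual UNIV (atom_act :: ('v::infinite, 'v) action) {w. distinct w}"
  using not_accepted_distinct accepted_by_mono[OF _ TrueI] by (rule contrapos_nn)

theorem mainTheorem8:
  fixes Q :: "'q itself"
  shows
    "(let \<R> = residual_languages UNIV (letter_act :: ('v::{countable, infinite}, 'v letter) action) in
        \<not> (\<forall>L\<in>\<R>. \<forall>L'\<in>\<R>. L \<union> L' \<in> \<R>) \<and>
        \<not> (\<forall>L\<in>\<R>. \<forall>L'\<in>\<R>. L \<inter> L' \<in> \<R>)) \<and>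
     (let \<R> = residual_languages UNIV (atom_act :: ('v, 'v) action) in
        \<not> (\<forall>L\<in>\<R>. rev ` L \<in> \<R>) \<and>
        \<not> (\<forall>L\<in>\<R>. lists UNIV - L \<in> \<R>)) \<and>

     accepted_by TYPE(nat) residual UNIV (letter_act :: ('v, 'v letter) action) L_r \<and>
     accepted_by TYPE(nat) (\<lambda>A. deterministic A \<and> residual A) UNIV (letter_act :: ('v, 'v letter) action) L_2 \<and>

     \<not> accepted_by Q residual UNIV (letter_act :: ('v, 'v letter) action) (L_r \<union> L_2) \<and>

     \<not> accepted_by Q residual UNIV (letter_act :: ('v, 'v letter) action) (L_r \<inter> L_2) \<and>

     accepted_by TYPE(nat) (\<lambda>A. deterministic A \<and> residual A) UNIV (atom_act :: ('v, 'v) action) first_fresh \<and>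
     \<not> accepted_by Q residual UNIV (atom_act :: ('v, 'v) action) (rev ` first_fresh) \<and>

     accepted_by TYPE(nat) residual UNIV (atom_act :: ('v, 'v) action) some_repeated \<and>
     \<not> accepted_by Q (\<lambda>_. True) UNIV (atom_act :: ('v, 'v) action) (lists UNIV - some_repeated) \<and>
     \<not> accepted_by Q residual UNIV (atom_act :: ('v, 'v) action) (lists UNIV - some_repeated)"
proof -
  have complement: "lists UNIV - some_repeated = {w :: 'v list. distinct w}"
    by (auto simp: some_repeated_eq)
  let ?\<R>\<^sub>\<Sigma> = "residual_languages UNIV (letter_act :: ('v, 'v letter) action)"
    and ?\<R>\<^sub>A = "residual_languages UNIV (atom_act :: ('v, 'v) action)"
  \<comment> \<open>For \<open>L_2\<close> and \<open>first_fresh\<close> the automata are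
    deterministic and residual; \<open>accepted_by_mono\<close> with \<open>conjunct2\<close>
    retains residuality.\<close>
  have "L_r \<in> ?\<R>\<^sub>\<Sigma>" "L_2 \<in> ?\<R>\<^sub>\<Sigma>" "first_fresh \<in> ?\<R>\<^sub>A" "some_repeated \<in> ?\<R>\<^sub>A"
    unfolding residual_languages_def mem_Collect_eq
    by (rule accepted_L_r accepted_some_repeated accepted_by_mono[OF accepted_L_2]
      accepted_by_mono[OF accepted_first_fresh] | erule conjunct2)+
  \<comment> \<open>The negative results hold for every state type; here they are taken at
    \<open>nat\<close>, the type used in \<open>residual_languages\<close>.\<close>
  moreover have "L_r \<union> L_2 \<notin> ?\<R>\<^sub>\<Sigma>" "L_r \<inter> L_2 \<notin> ?\<R>\<^sub>\<Sigma>" "rev ` first_fresh \<notin> ?\<R>\<^sub>A"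
    "lists UNIV - some_repeated \<notin> ?\<R>\<^sub>A"
    unfolding residual_languages_def mem_Collect_eq complement
    by (rule not_accepted_union not_accepted_inter not_accepted_rev_first_fresh
      not_accepted_by_residual_distinct)+
  ultimately have "\<not> (\<forall>L\<in>?\<R>\<^sub>\<Sigma>. \<forall>L'\<in>?\<R>\<^sub>\<Sigma>. L \<union> L' \<in> ?\<R>\<^sub>\<Sigma>)"
    "\<not> (\<forall>L\<in>?\<R>\<^sub>\<Sigma>. \<forall>L'\<in>?\<R>\<^sub>\<Sigma>. L \<inter> L' \<in> ?\<R>\<^sub>\<Sigma>)"
    "\<not> (\<forall>L\<in>?\<R>\<^sub>A. rev ` L \<in> ?\<R>\<^sub>A)"
    "\<not> (\<forall>L\<in>?\<R>\<^sub>A. lists UNIV - L \<in> ?\<R>\<^sub>A)"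
    by blast+
  then show ?thesis
    unfolding Let_def complement
    by (intro conjI accepted_L_r accepted_L_2 not_accepted_union not_accepted_inter
      accepted_first_fresh not_accepted_rev_first_fresh accepted_some_repeated
      not_accepted_distinct not_accepted_by_residual_distinct)
qed

end
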